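(* Let $d\geq 2$ be a fixed integer. Define \[ \alpha_d:=\sum_{p}\frac{(p-1)^2}{p^{d+2}},\qquad \beta_d:=\sum_{p}\left(\frac{(p-1)^2}{p^{d+2}}\right)^2,\qquad \gamma_d:=1-\prod_{p}\left(1-\frac{(p-1)^2}{p^{d+2}}\right), \] where $p$ runs over all primes. Then \[ \mu_d:=\lim_{H\to\infty}\frac{\sum_{f\in\mathcal{F}_d(H)}\psi(f)}{\sum_{f\in\mathcal{F}_d(H)}1}=\frac{\alpha_d}{\gamma_d}, \] and \[ \sigma_d^2:=\lim_{H\to\infty}\frac{\sum_{f\in\mathcal{F}_d(H)}(\psi(f)-\mu_d)^2}{\sum_{f\in\mathcal{F}_d(H)}1}=\frac{\alpha_d+\alpha_d^2-\beta_d-\mu_d\alpha_d}{\gamma_d}. \]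
   Context: For a polynomial $f(x)=a_dx^d+\cdots+a_1x+a_0\in\mathbb{Z}[x]$ of degree $d$ (so $a_d\neq 0$) and a prime $p$, $f$ is called $p$-Eisenstein if $p\mid a_i$ for $i=0,1,\dots,d-1$, $p^2\nmid a_0$, and $p\nmid a_d$; $f$ is called Eisenstein if it is $p$-Eisenstein for some prime $p$. The height of $f$ is $\max\{|a_0|,\dots,|a_d|\}$. For $H>0$, $\mathcal{F}_d(H)$ denotes the set of Eisenstein polynomials in $\mathbb{Z}[x]$ of degree $d$ and height at most $H$. For such $f$, $\psi(f)$ denotes the number of primes $p$ for which $f$ is $p$-Eisenstein. *)

theory Defs
  imports "HOL-Analysis.Analysis" "HOL-Computational_Algebra.Computational_Algebra"
begin

definition p_eisenstein :: "nat \<Rightarrow> int poly \<Rightarrow> bool" where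
  "p_eisenstein p f \<longleftrightarrow>
     (\<forall>i<degree f. int p dvd coeff f i) \<and>
     \<not> (int p)\<^sup>2 dvd coeff f 0 \<and>
     \<not> int p dvd coeff f (degree f)"

definition eisenstein :: "int poly \<Rightarrow> bool" where
  "eisenstein f \<longleftrightarrow> (\<exists>p. prime p \<and> p_eisenstein p f)"

definition poly_height :: "int poly \<Rightarrow> int" where
  "poly_height f = Max ((\<lambda>i. \<bar>coeff f i\<bar>) ` {..degree f})"

definition eisenstein_polys :: "nat \<Rightarrow> real \<Rightarrow> int poly set" where
  "eisenstein_polys d H =
     {f. eisenstein f \<and> degree f = d \<and> real_of_int (poly_height f) \<le> H}"

text \<open>
  For an Eisenstein polynomial of positive degree the set below is finite,
  since each of its elements divides the nonzero constant coefficient.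
\<close>
definition eisenstein_psi :: "int poly \<Rightarrow> nat" where
  "eisenstein_psi f = card {p. prime p \<and> p_eisenstein p f}"

definition local_density :: "nat \<Rightarrow> nat \<Rightarrow> real" where
  "local_density d p = (real p - 1)\<^sup>2 / real p ^ (d + 2)"

definition eisenstein_alpha :: "nat \<Rightarrow> real" where
  "eisenstein_alpha d = (\<Sum>\<^sub>\<infinity>p | prime p. local_density d p)"

definition eisenstein_beta :: "nat \<Rightarrow> real" where
  "eisenstein_beta d = (\<Sum>\<^sub>\<infinity>p | prime p. (local_density d p)\<^sup>2)"

text \<open>
  The product over all primes is taken over all natural numbers in increasing order,
  with factor 1 at the non-primes.
\<close>
definition eisenstein_gamma :: "nat \<Rightarrow> real" where
  "eisenstein_gamma d = 1 - (\<Prod>n. if prime n then 1 - local_density d n else 1)"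

definition psi_mean :: "nat \<Rightarrow> real \<Rightarrow> real" where
  "psi_mean d H =
     (\<Sum>f\<in>eisenstein_polys d H. real (eisenstein_psi f)) / (\<Sum>f\<in>eisenstein_polys d H. 1)"

text \<open>
  \<open>Lim\<close> is only meaningful when the limit exists, so a statement about
  the next constant and \<open>eisenstein_sigma2\<close> has to assert the convergence separately.
\<close>
definition eisenstein_mu :: "nat \<Rightarrow> real" where
  "eisenstein_mu d = Lim at_top (psi_mean d)"

text \<open>The deviation is taken from the limit mean, not from the mean at height \<open>H\<close>.\<close>
definition psi_variance :: "nat \<Rightarrow> real \<Rightarrow> real" where
  "psi_variance d H =
     (\<Sum>f\<in>eisenstein_polys d H. (real (eisenstein_psi f) - eisenstein_mu d)\<^sup>2) /
     (\<Sum>f\<in>eisenstein_polys d H. 1)"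

definition eisenstein_sigma2 :: "nat \<Rightarrow> real" where
  "eisenstein_sigma2 d = Lim at_top (psi_variance d)"

end

(* Divide by the number (2N+1)^(d+1) of all coefficient vectors in [-N, N]. For a finite nonempty
   set S of primes, the conditions "p-Eisenstein for all p in S" split into one sieve condition per
   coefficient, so their density is the product of the local densities over S; moreover, because
   a nonzero a_0 divisible by m = prod S forces m <= N, this density is at most (3/2)^d / m^d for
   every N. As d >= 2, the bound is summable over primes and over pairs of distinct primes, so limits
   may be taken termwise (dominated convergence for sums) in
     sum psi            = sum over p of the p-Eisenstein counts,
     sum psi (psi - 1)  = sum over p, q distinct of the simultaneous counts,
     sum 1              = sum over n of the counts of f whose least Eisenstein prime is n.
   The limits are alpha, alpha^2 - beta, and, after telescoping the partial products, gamma. *)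
theory Submission
  imports Defs
begin

section \<open>Multiples and sieved multiples in a symmetric interval\<close>

text \<open>The multiples are \<open>k * b\<close> with \<open>b\<close> in the symmetric interval
  of radius \<open>N div k\<close>. The extra 1 is the multiple 0, the one obstacle to a bound of
  order \<open>1 / k\<close> for the density that is uniform in \<open>N\<close>.\<close>

lemma card_multiples_symmetric_interval:
  assumes "k > 0"
  shows "card {a \<in> {-int N..int N}. int k dvd a} = 2 * (N div k) + 1"
proof -
  define M where "M = int (N div k)"
  have "{a \<in> {-int N..int N}. int k dvd a} = (\<lambda>b. int k * b) ` {-M..M}"
  proof (intro equalityI subsetI)
    fix a assume a: "a \<in> {a \<in> {-int N..int N}. int k dvd a}"
    then obtain b where b: "a = int k * b" by (auto elim: dvdE)
    have "\<bar>a\<bar> \<le> int N" using a by auto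
    then have "int k * \<bar>b\<bar> \<le> int N" by (simp add: b abs_mult)
    then have "\<bar>b\<bar> \<le> M"
      unfolding M_def zdiv_int using assms zdiv_mono1[of "int k * \<bar>b\<bar>" "int N" "int k"] by simp
    then show "a \<in> (\<lambda>b. int k * b) ` {-M..M}" using b by (intro image_eqI[of _ _ b]) auto
  next
    fix a assume "a \<in> (\<lambda>b. int k * b) ` {-M..M}"
    then obtain b where b: "a = int k * b" "b \<in> {-M..M}" by (rule imageE)
    then have "\<bar>b\<bar> \<le> M" by auto
    with b have "\<bar>a\<bar> \<le> int k * M" by (simp add: abs_mult mult_left_mono)
    also have "\<dots> \<le> int N"
      unfolding M_def by (metis of_nat_mult of_nat_le_iff times_div_less_eq_dividend)
    finally show "a \<in> {a \<in> {-int N..int N}. int k dvd a}" using b by auto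
  qed
  moreover have "inj_on (\<lambda>b. int k * b) {-M..M}" using assms by (auto simp: inj_on_def)
  moreover have "M \<ge> 0" by (simp add: M_def)
  ultimately show ?thesis by (simp add: card_image M_def)
qed

text \<open>Writing \<open>N = k * (N div k) + N mod k\<close> shows that the count differs from
  \<open>(2 * N + 1) / k\<close> by an amount bounded independently of \<open>N\<close>, so the
  error in the density is of order \<open>1 / N\<close>.\<close>

lemma density_multiples:
  assumes "k > 0"
  shows "(\<lambda>N. real (card {a \<in> {-int N..int N}. int k dvd a}) / (2 * real N + 1)) \<longlonglongrightarrow> 1 / real k"
proof -
  have "norm (real (card {a \<in> {-int N..int N}. int k dvd a}) / (2 * real N + 1) - 1 / real k)
        \<le> 2 * inverse (real (Suc N))" for N
  proof -
    have "real N = real (k * (N div k) + N mod k)" by simp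
    then have e: "real N = real k * real (N div k) + real (N mod k)" by (simp only: of_nat_add of_nat_mult)
    have l: "N mod k < k" using assms by simp
    have "real (card {a \<in> {-int N..int N}. int k dvd a}) / (2 * real N + 1) - 1 / real k
        = (real k * (2 * real (N div k) + 1) - (2 * real N + 1)) / (real k * (2 * real N + 1))"
      using assms unfolding card_multiples_symmetric_interval[OF assms] by (simp add: field_simps)
    also have "\<dots> = (real k - 1 - 2 * real (N mod k)) / (real k * (2 * real N + 1))"
      by (subst e) (simp add: algebra_simps e[symmetric])
    finally have "norm (real (card {a \<in> {-int N..int N}. int k dvd a}) / (2 * real N + 1) - 1 / real k)
       = \<bar>real k - 1 - 2 * real (N mod k)\<bar> / (real k * (2 * real N + 1))"
      by (simp add: abs_mult)
    also have "\<dots> \<le> (2 * real k) / (real k * (2 * real N + 1))"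
      using l by (intro divide_right_mono) auto
    also have "\<dots> \<le> 2 * inverse (real (Suc N))"
      using assms by (simp add: divide_simps)
    finally show ?thesis .
  qed
  moreover have "(\<lambda>N. 2 * inverse (real (Suc N))) \<longlonglongrightarrow> 0"
    using tendsto_mult_right_zero[OF LIMSEQ_inverse_real_of_nat, of 2] by simp
  ultimately have "(\<lambda>N. real (card {a \<in> {-int N..int N}. int k dvd a}) / (2 * real N + 1) - 1 / real k) \<longlonglongrightarrow> 0"
    by (rule Lim_null_comparison[OF always_eventually[OF allI]])
  then show ?thesis by (rule LIM_zero_cancel)
qed

text \<open>The parameter \<open>r\<close> only serves the induction on \<open>S\<close>: removing the multiples of \<open>m * q\<close>
  replaces \<open>r\<close> by \<open>r * q\<close> in the subtracted term.\<close>
lemma density_sieved_multiples: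
  fixes S :: "nat set"
  assumes "finite S" "\<forall>p\<in>S. prime p" "\<And>p. p \<in> S \<Longrightarrow> coprime p r" "m > 0" "r > 0"
  shows "(\<lambda>N. real (card {a \<in> {-int N..int N}. int (m * r) dvd a \<and> (\<forall>p\<in>S. \<not> int (m * p) dvd a)})
            / (2 * real N + 1)) \<longlonglongrightarrow> (1 / real (m * r)) * (\<Prod>p\<in>S. 1 - 1 / real p)"
  using assms(1-3,5)
proof (induction S arbitrary: r rule: finite_induct)
  case empty
  then show ?case using density_multiples[of "m * r"] assms(4) by simp
next
  case (insert q S)
  define A where "A r N = {a \<in> {-int N..int N}. int (m * r) dvd a \<and> (\<forall>p\<in>S. \<not> int (m * p) dvd a)}" for r N
  have q: "prime q" "coprime q r" using insert by auto
  \<comment> \<open>After cancelling \<open>m\<close>, the quotient is divisible by the coprime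
    numbers \<open>r\<close> and \<open>q\<close>, hence by their product.\<close>
  have "int (m * (r * q)) dvd a \<longleftrightarrow> int (m * r) dvd a \<and> int (m * q) dvd a" for a
  proof
    assume "int (m * r) dvd a \<and> int (m * q) dvd a"
    then have "int m dvd a" by (metis dvd_mult_left of_nat_mult)
    then obtain b where b: "a = int m * b" ..
    with \<open>int (m * r) dvd a \<and> int (m * q) dvd a\<close> have "int r dvd b" "int q dvd b"
      using assms(4) by auto
    moreover have "coprime (int r) (int q)" using q by (simp add: coprime_commute)
    ultimately have "int r * int q dvd b" by (rule divides_mult)
    then show "int (m * (r * q)) dvd a" using b by simp
  next
    assume h: "int (m * (r * q)) dvd a"
    have "m * r dvd m * (r * q)" "m * q dvd m * (r * q)" by simp_all
    then show "int (m * r) dvd a \<and> int (m * q) dvd a"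
      using h dvd_trans of_nat_dvd_iff by blast
  qed
  then have eq: "{a \<in> {-int N..int N}. int (m * r) dvd a \<and> (\<forall>p\<in>insert q S. \<not> int (m * p) dvd a)}
        = A r N - A (r * q) N" and sub: "A (r * q) N \<subseteq> A r N" for N
    unfolding A_def by blast+
  have fin: "finite (A r N)" for r N
    by (rule finite_subset[of _ "{-int N..int N}"]) (auto simp: A_def)
  have "real (card (A r N - A (r * q) N)) = real (card (A r N)) - real (card (A (r * q) N))" for N
    using sub fin by (simp add: card_Diff_subset card_mono of_nat_diff)
  then have eq2: "real (card {a \<in> {-int N..int N}. int (m * r) dvd a \<and> (\<forall>p\<in>insert q S. \<not> int (m * p) dvd a)}) / (2 * real N + 1)
      = real (card (A r N)) / (2 * real N + 1) - real (card (A (r * q) N)) / (2 * real N + 1)" for N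
    unfolding eq by (simp add: diff_divide_distrib)
  have "(\<lambda>N. real (card (A r N)) / (2 * real N + 1)) \<longlonglongrightarrow> (1 / real (m * r)) * (\<Prod>p\<in>S. 1 - 1 / real p)"
    unfolding A_def using insert by auto
  moreover have "coprime p (r * q)" if "p \<in> S" for p
    using that insert by (auto intro!: primes_coprime)
  then have "(\<lambda>N. real (card (A (r * q) N)) / (2 * real N + 1)) \<longlonglongrightarrow> (1 / real (m * (r * q))) * (\<Prod>p\<in>S. 1 - 1 / real p)"
    unfolding A_def using insert q by (intro insert.IH) (auto simp: prime_gt_0_nat)
  ultimately have "(\<lambda>N. real (card (A r N)) / (2 * real N + 1) - real (card (A (r * q) N)) / (2 * real N + 1))
     \<longlonglongrightarrow> (1 / real (m * r)) * (\<Prod>p\<in>S. 1 - 1 / real p) - (1 / real (m * (r * q))) * (\<Prod>p\<in>S. 1 - 1 / real p)"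
    by (rule tendsto_diff)
  \<comment> \<open>Subtracting the term with \<open>r * q\<close> supplies the new factor
    \<open>1 - 1 / q\<close>.\<close>
  also have "(1 / real (m * r)) * (\<Prod>p\<in>S. 1 - 1 / real p) - (1 / real (m * (r * q))) * (\<Prod>p\<in>S. 1 - 1 / real p)
     = (1 / real (m * r)) * (\<Prod>p\<in>insert q S. 1 - 1 / real p)"
    using insert.hyps by (simp add: algebra_simps diff_divide_distrib)
  finally show ?case unfolding eq2 .
qed

lemma card_nonzero_multiples_le:
  assumes "m > 0"
  shows "real (card {a \<in> {-int N..int N}. int m dvd a \<and> a \<noteq> 0}) \<le> (2 * real N + 1) / real m"
proof -
  have "{a \<in> {-int N..int N}. int m dvd a \<and> a \<noteq> 0} = {a \<in> {-int N..int N}. int m dvd a} - {0}" by auto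
  then have c: "card {a \<in> {-int N..int N}. int m dvd a \<and> a \<noteq> 0} = 2 * (N div m)"
    using card_multiples_symmetric_interval[OF assms, of N] by (simp add: card_Diff_singleton)
  have "real (N div m) \<le> real N / real m" by (rule of_nat_div_le_of_nat)
  then have "2 * real (N div m) \<le> (2 * real N + 1) / real m"
    using assms by (simp add: field_simps)
  with c show ?thesis by simp
qed

text \<open>For \<open>m \<le> N\<close> the multiple 0 is absorbed by \<open>1 \<le> N / m\<close>,
  giving at most \<open>3 * N / m\<close> multiples. This is the source of the constant 3/2 in the
  uniform density bound.\<close>

lemma card_multiples_le:
  assumes "m > 0" "m \<le> N"
  shows "real (card {a \<in> {-int N..int N}. int m dvd a}) \<le> 3 / 2 * (2 * real N + 1) / real m"
proof -
  have "real (N div m) \<le> real N / real m" by (rule of_nat_div_le_of_nat)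
  moreover have "1 \<le> real N / real m" using assms by simp
  ultimately have "2 * real (N div m) + 1 \<le> 3 * (real N / real m)" by linarith
  also have "\<dots> \<le> 3 / 2 * (2 * real N + 1) / real m" using assms by (simp add: field_simps)
  finally show ?thesis unfolding card_multiples_symmetric_interval[OF assms(1)] by simp
qed

section \<open>Counting polynomials through their coefficient vectors\<close>

text \<open>Asking only for \<open>degree f \<le> d\<close> makes the polynomials correspond to all
  coefficient vectors, so that counts become products. That the leading coefficient is nonzero has
  to be enforced through \<open>A d\<close>.\<close>

lemma bij_betw_coeff_PiE:
  "bij_betw (\<lambda>f. restrict (coeff f) {..d})
     {f :: 'a::zero poly. degree f \<le> d \<and> (\<forall>i\<le>d. coeff f i \<in> A i)} (PiE {..d} A)"
proof (rule bij_betwI')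
  fix f g assume *: "f \<in> {f :: 'a poly. degree f \<le> d \<and> (\<forall>i\<le>d. coeff f i \<in> A i)}"
     "g \<in> {f :: 'a poly. degree f \<le> d \<and> (\<forall>i\<le>d. coeff f i \<in> A i)}"
  show "restrict (coeff f) {..d} = restrict (coeff g) {..d} \<longleftrightarrow> f = g"
  proof
    assume h: "restrict (coeff f) {..d} = restrict (coeff g) {..d}"
    show "f = g"
    proof (rule poly_eqI)
      fix i show "coeff f i = coeff g i"
        using fun_cong[OF h, of i] * by (cases "i \<le> d") (auto simp: coeff_eq_0)
    qed
  qed simp
next
  fix a assume a: "a \<in> PiE {..d} A"
  define f where "f = Poly (map a [0..<Suc d])"
  have c: "coeff f i = (if i \<le> d then a i else 0)" for i
    by (auto simp: f_def nth_default_def simp del: upt_Suc)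
  have "degree f \<le> d" by (rule degree_le) (simp add: c)
  moreover have "restrict (coeff f) {..d} = a"
    using a by (auto simp: fun_eq_iff c PiE_def extensional_def)
  ultimately show "\<exists>f\<in>{f. degree f \<le> d \<and> (\<forall>i\<le>d. coeff f i \<in> A i)}. a = restrict (coeff f) {..d}"
    using a by (intro bexI[of _ f]) (auto simp: c PiE_def)
qed auto

lemma card_polys_coeffs_in:
  "card {f :: 'a::zero poly. degree f \<le> d \<and> (\<forall>i\<le>d. coeff f i \<in> A i)} = (\<Prod>i\<le>d. card (A i))"
  using bij_betw_same_card[OF bij_betw_coeff_PiE, of d A] by (simp add: card_PiE)

lemma finite_polys_coeffs_in:
  assumes "\<And>i. i \<le> d \<Longrightarrow> finite (A i)"
  shows "finite {f :: 'a::zero poly. degree f \<le> d \<and> (\<forall>i\<le>d. coeff f i \<in> A i)}"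
  using bij_betw_finite[OF bij_betw_coeff_PiE, of d A] assms by (auto intro!: finite_PiE)

section \<open>Eisenstein conditions as a sieve on each coefficient\<close>

text \<open>The excluded divisors are \<open>m * p\<close> instead of \<open>p\<close>, so that one
  shape serves all coefficients: \<open>m = 1\<close> for the leading one,
  \<open>m = \<Prod>S\<close> for the constant one, and an empty sieving set for those in
  between.\<close>

definition sieved_multiples :: "nat \<Rightarrow> nat \<Rightarrow> nat set \<Rightarrow> int set" where
  "sieved_multiples N m S = {a \<in> {-int N..int N}. int m dvd a \<and> (\<forall>p\<in>S. \<not> int (m * p) dvd a)}"

lemma finite_sieved_multiples [simp]: "finite (sieved_multiples N m S)"
  by (rule finite_subset[of _ "{-int N..int N}"]) (auto simp: sieved_multiples_def)

lemma density_sieved: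
  assumes "finite S" "\<forall>p\<in>S. prime p" "m > 0"
  shows "(\<lambda>N. real (card (sieved_multiples N m S)) / (2 * real N + 1))
            \<longlonglongrightarrow> (1 / real m) * (\<Prod>p\<in>S. 1 - 1 / real p)"
  using density_sieved_multiples[of S 1 m] assms unfolding sieved_multiples_def by simp

lemma prod_primes_dvd_iff:
  fixes a :: int
  assumes "finite S" "\<forall>p\<in>S. prime p"
  shows "int (\<Prod>S) dvd a \<longleftrightarrow> (\<forall>p\<in>S. int p dvd a)"
  using assms
proof (induction S rule: finite_induct)
  case (insert q S)
  have "coprime q (\<Prod>S)"
    using insert by (intro prod_coprime_right) (auto intro!: primes_coprime)
  then have "coprime (int q) (int (\<Prod>S))" unfolding coprime_int_iff .
  then have "int q * int (\<Prod>S) dvd a \<longleftrightarrow> int q dvd a \<and> int (\<Prod>S) dvd a"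
    by (metis divides_mult dvd_mult_left dvd_mult_right)
  then show ?case using insert by (simp del: of_nat_prod)
qed simp

text \<open>Split \<open>\<Prod>S = p * m\<close> with \<open>m\<close> coprime to \<open>p\<close>.
  Then \<open>\<Prod>S * p\<close> is \<open>p * p * m\<close>, and divisibility by \<open>m\<close>
  is already given.\<close>

lemma prod_primes_mult_dvd_iff:
  fixes a :: int
  assumes "finite S" "\<forall>p\<in>S. prime p" "p \<in> S" "int (\<Prod>S) dvd a"
  shows "int (\<Prod>S * p) dvd a \<longleftrightarrow> (int p)\<^sup>2 dvd a"
proof -
  define m where "m = \<Prod>(S - {p})"
  have m: "\<Prod>S = p * m" unfolding m_def using assms by (simp add: prod.remove)
  have "coprime p m"
    unfolding m_def using assms by (intro prod_coprime_right) (auto intro!: primes_coprime)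
  then have cop: "coprime ((int p)\<^sup>2) (int m)" by simp
  show ?thesis
  proof
    assume "(int p)\<^sup>2 dvd a"
    moreover have "int m dvd a" using assms(4) m by (metis dvd_mult_right of_nat_mult)
    ultimately have "(int p)\<^sup>2 * int m dvd a" using cop by (rule divides_mult)
    then show "int (\<Prod>S * p) dvd a" by (simp add: m power2_eq_square mult_ac)
  next
    assume "int (\<Prod>S * p) dvd a"
    then have "(int p)\<^sup>2 * int m dvd a" by (simp add: m power2_eq_square mult_ac)
    then show "(int p)\<^sup>2 dvd a" by (rule dvd_mult_left)
  qed
qed

definition bounded_polys :: "nat \<Rightarrow> nat \<Rightarrow> int poly set" where
  "bounded_polys d N = {f. degree f = d \<and> (\<forall>i\<le>d. \<bar>coeff f i\<bar> \<le> int N)}"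

lemma finite_bounded_polys [simp]: "finite (bounded_polys d N)"
  by (rule finite_subset[OF _ finite_polys_coeffs_in[of d "\<lambda>_. {-int N..int N}"]])
     (auto simp: bounded_polys_def abs_le_iff)

text \<open>Given that \<open>\<Prod>S\<close> divides \<open>a\<close>, the condition that \<open>p\<^sup>2\<close> does not divide \<open>a\<close> says that
  \<open>\<Prod>S * p\<close> does not, which makes the constant coefficient another case of the same sieve.\<close>
definition eisenstein_coeffs :: "nat \<Rightarrow> nat \<Rightarrow> nat set \<Rightarrow> nat \<Rightarrow> int set" where
  "eisenstein_coeffs d N S i =
     (if i = 0 then sieved_multiples N (\<Prod>S) S
      else if i < d then sieved_multiples N (\<Prod>S) {}
      else sieved_multiples N 1 S)"

text \<open>For a fixed set of primes the conditions on different coefficients are independent of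
  each other, so the polynomials form a product set that can be counted coefficient by
  coefficient.\<close>

lemma eisenstein_polys_at_primes_eq:
  assumes "finite S" "S \<noteq> {}" "\<forall>p\<in>S. prime p" "d > 0"
  shows "{f \<in> bounded_polys d N. \<forall>p\<in>S. p_eisenstein p f}
       = {f. degree f \<le> d \<and> (\<forall>i\<le>d. coeff f i \<in> eisenstein_coeffs d N S i)}"
proof (intro set_eqI iffI)
  fix f assume f: "f \<in> {f \<in> bounded_polys d N. \<forall>p\<in>S. p_eisenstein p f}"
  then have deg: "degree f = d" and bd: "\<And>i. i \<le> d \<Longrightarrow> coeff f i \<in> {-int N..int N}"
    by (auto simp: bounded_polys_def abs_le_iff)
  have dv: "int (\<Prod>S) dvd coeff f i" if "i < d" for i
    unfolding prod_primes_dvd_iff[OF assms(1,3)] using f that deg by (auto simp: p_eisenstein_def)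
  have "\<not> int (\<Prod>S * p) dvd coeff f 0" if "p \<in> S" for p
    unfolding prod_primes_mult_dvd_iff[OF assms(1,3) that dv[OF assms(4)]]
    using f that by (auto simp: p_eisenstein_def)
  moreover have "\<not> int p dvd coeff f d" if "p \<in> S" for p
    using f that deg by (auto simp: p_eisenstein_def)
  ultimately show "f \<in> {f. degree f \<le> d \<and> (\<forall>i\<le>d. coeff f i \<in> eisenstein_coeffs d N S i)}"
    using dv bd deg assms(4) unfolding eisenstein_coeffs_def sieved_multiples_def by (auto simp del: of_nat_prod of_nat_mult)
next
  fix f assume "f \<in> {f. degree f \<le> d \<and> (\<forall>i\<le>d. coeff f i \<in> eisenstein_coeffs d N S i)}"
  then have deg: "degree f \<le> d" and c: "\<And>i. i \<le> d \<Longrightarrow> coeff f i \<in> eisenstein_coeffs d N S i" by auto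
  have "\<not> int p dvd coeff f d" if "p \<in> S" for p
    using c[of d] assms(4) that by (auto simp: eisenstein_coeffs_def sieved_multiples_def)
  note lead = this
  \<comment> \<open>Some prime of the nonempty set \<open>S\<close> does not divide this
    coefficient, which excludes 0 and fixes the degree.\<close>
  have "coeff f d \<noteq> 0" using lead assms(2) by auto
  then have deg: "degree f = d" using deg le_degree by fastforce
  have dv: "int (\<Prod>S) dvd coeff f i" if "i < d" for i
    using c[of i] that by (auto simp: eisenstein_coeffs_def sieved_multiples_def split: if_splits)
  have dvp: "int p dvd coeff f i" if "i < d" "p \<in> S" for i p
    using dv[OF that(1)] that unfolding prod_primes_dvd_iff[OF assms(1,3)] by auto
  have "\<not> (int p)\<^sup>2 dvd coeff f 0" if "p \<in> S" for p
    unfolding prod_primes_mult_dvd_iff[OF assms(1,3) that dv[OF assms(4)], symmetric]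
    using c[of 0] that by (auto simp: eisenstein_coeffs_def sieved_multiples_def)
  moreover have "\<bar>coeff f i\<bar> \<le> int N" if "i \<le> d" for i
    using c[OF that] by (auto simp: eisenstein_coeffs_def sieved_multiples_def split: if_splits)
  ultimately show "f \<in> {f \<in> bounded_polys d N. \<forall>p\<in>S. p_eisenstein p f}"
    using deg lead dvp by (auto simp: bounded_polys_def p_eisenstein_def)
qed

section \<open>Densities of simultaneous Eisenstein conditions\<close>

text \<open>The denominator counts all coefficient vectors with entries in [-N, N], including those
  with leading coefficient 0. With this normalisation densities factor over the coefficients, and it
  cancels in the final ratios.\<close>

definition box_density :: "nat \<Rightarrow> nat \<Rightarrow> (int poly \<Rightarrow> bool) \<Rightarrow> real" where
  "box_density d N P = real (card {f \<in> bounded_polys d N. P f}) / (2 * real N + 1) ^ (d + 1)"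

lemma box_density_nonneg: "box_density d N P \<ge> 0"
  by (simp add: box_density_def)

lemma box_density_mono:
  assumes "\<And>f. f \<in> bounded_polys d N \<Longrightarrow> P f \<Longrightarrow> Q f"
  shows "box_density d N P \<le> box_density d N Q"
  unfolding box_density_def using assms
  by (intro divide_right_mono of_nat_mono card_mono) (auto intro: finite_subset[OF _ finite_bounded_polys])

lemma box_density_eisenstein_at_primes:
  assumes "finite S" "S \<noteq> {}" "\<forall>p\<in>S. prime p" "d > 0"
  shows "box_density d N (\<lambda>f. \<forall>p\<in>S. p_eisenstein p f)
       = (\<Prod>i\<le>d. real (card (eisenstein_coeffs d N S i)) / (2 * real N + 1))"
  unfolding box_density_def eisenstein_polys_at_primes_eq[OF assms] card_polys_coeffs_in
  by (simp add: prod_dividef)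

text \<open>With \<open>m\<close> the product of \<open>S\<close> and \<open>w\<close> the product
  of the \<open>1 - 1 / p\<close>, the constant coefficient contributes \<open>w / m\<close>, the
  leading one \<open>w\<close>, and each of the \<open>d - 1\<close> others \<open>1 / m\<close>.
  The total \<open>w\<^sup>2 / m ^ d\<close> factors over the primes into local densities.\<close>

lemma box_density_eisenstein_tendsto:
  assumes "finite S" "S \<noteq> {}" "\<forall>p\<in>S. prime p" "d > 0"
  shows "(\<lambda>N. box_density d N (\<lambda>f. \<forall>p\<in>S. p_eisenstein p f)) \<longlonglongrightarrow> (\<Prod>p\<in>S. local_density d p)"
proof -
  define m where "m = \<Prod>S"
  define w where "w = (\<Prod>p\<in>S. 1 - 1 / real p)"
  define c where "c i = (if i = 0 then 1 / real m * w else if i < d then 1 / real m else w)" for i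
  have m: "m > 0" unfolding m_def using assms(3) by (auto intro!: prod_pos simp: prime_gt_0_nat)
  have lim: "(\<lambda>N. \<Prod>i\<le>d. real (card (eisenstein_coeffs d N S i)) / (2 * real N + 1)) \<longlonglongrightarrow> (\<Prod>i\<le>d. c i)"
  proof (rule tendsto_prod)
    fix i
    show "(\<lambda>N. real (card (eisenstein_coeffs d N S i)) / (2 * real N + 1)) \<longlonglongrightarrow> c i"
      using density_sieved[OF assms(1,3) m] density_sieved[OF finite.emptyI _ m] density_sieved[OF assms(1,3), of 1]
      unfolding eisenstein_coeffs_def c_def m_def w_def by simp
  qed
  have "{..d} = insert 0 (insert d {1..<d})" using assms(4) by auto
  then have "(\<Prod>i\<le>d. c i) = c 0 * c d * (\<Prod>i\<in>{1..<d}. c i)" using assms(4) by simp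
  also have "(\<Prod>i\<in>{1..<d}. c i) = (\<Prod>i\<in>{1..<d}. 1 / real m)" by (rule prod.cong) (auto simp: c_def)
  also have "\<dots> = (1 / real m) ^ (d - 1)" by simp
  also have "c 0 * c d * (1 / real m) ^ (d - 1) = (1 / real m) ^ d * w\<^sup>2"
    using assms(4) by (cases d) (simp_all add: c_def power2_eq_square)
  also have "1 / real m = (\<Prod>p\<in>S. 1 / real p)" by (simp add: m_def prod_dividef)
  also have "(\<Prod>p\<in>S. 1 / real p) ^ d * w\<^sup>2 = (\<Prod>p\<in>S. (1 / real p) ^ d * (1 - 1 / real p)\<^sup>2)"
    by (simp add: w_def prod.distrib prod_power_distrib)
  also have "\<dots> = (\<Prod>p\<in>S. local_density d p)"
  proof (rule prod.cong)
    fix p assume "p \<in> S"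
    then have "p > 0" using assms(3) prime_gt_0_nat by blast
    then have eq: "1 - 1 / real p = (real p - 1) / real p" by (simp add: field_simps)
    show "(1 / real p) ^ d * (1 - 1 / real p)\<^sup>2 = local_density d p"
      unfolding eq local_density_def by (simp add: power_divide power_add power2_eq_square)
  qed simp
  finally show ?thesis using lim unfolding box_density_eisenstein_at_primes[OF assms] by simp
qed

text \<open>This is the majorant for dominated convergence, so it must hold for every
  \<open>N\<close>. For \<open>m \<le> N\<close> each of the \<open>d\<close> lower coefficients
  contributes at most \<open>3 / 2 / m\<close> and the leading one at most 1; for larger
  \<open>m\<close> no polynomial qualifies.\<close>

lemma box_density_eisenstein_le:
  assumes "finite S" "S \<noteq> {}" "\<forall>p\<in>S. prime p" "d > 0"
  shows "box_density d N (\<lambda>f. \<forall>p\<in>S. p_eisenstein p f) \<le> (3 / 2) ^ d / real (\<Prod>S) ^ d"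
proof -
  define m where "m = \<Prod>S"
  have m: "m > 0" unfolding m_def using assms(3) by (auto intro!: prod_pos simp: prime_gt_0_nat)
  \<comment> \<open>The value 0 is divisible by every \<open>m * p\<close>, so the sieve with
    nonempty \<open>S\<close> removes it.\<close>
  have sub: "eisenstein_coeffs d N S 0 \<subseteq> {a \<in> {-int N..int N}. int m dvd a \<and> a \<noteq> 0}"
    using assms(2) by (auto simp: eisenstein_coeffs_def sieved_multiples_def m_def)
  have fin: "finite {a \<in> {-int N..int N}. Q a}" for Q
    by (rule finite_subset[of _ "{-int N..int N}"]) auto
  show ?thesis
  proof (cases "m \<le> N")
    case True
    have "(\<Prod>i\<le>d. real (card (eisenstein_coeffs d N S i)) / (2 * real N + 1))
         \<le> (\<Prod>i\<le>d. if i < d then 3 / 2 / real m else 1)"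
    proof (rule prod_mono, rule conjI)
      fix i assume i: "i \<in> {..d}"
      have "real (card (eisenstein_coeffs d N S i)) \<le> (if i < d then 3 / 2 / real m else 1) * (2 * real N + 1)"
      proof (cases "i < d")
        case True
        have "eisenstein_coeffs d N S i \<subseteq> {a \<in> {-int N..int N}. int m dvd a}"
          using True by (auto simp: eisenstein_coeffs_def sieved_multiples_def m_def split: if_splits)
        then have "real (card (eisenstein_coeffs d N S i)) \<le> real (card {a \<in> {-int N..int N}. int m dvd a})"
          by (intro of_nat_mono card_mono fin)
        also have "\<dots> \<le> 3 / 2 * (2 * real N + 1) / real m" by (rule card_multiples_le[OF m \<open>m \<le> N\<close>])
        finally show ?thesis using True by simp
      next
        case False
        have "card (eisenstein_coeffs d N S i) \<le> card {-int N..int N}"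
          using False by (intro card_mono) (auto simp: eisenstein_coeffs_def sieved_multiples_def split: if_splits)
        then show ?thesis using False by simp
      qed
      then show "real (card (eisenstein_coeffs d N S i)) / (2 * real N + 1) \<le> (if i < d then 3 / 2 / real m else 1)"
        by (subst pos_divide_le_eq) auto
    qed simp
    also have "(\<Prod>i\<le>d. if i < d then 3 / 2 / real m else 1) = (3 / 2 / real m) ^ d"
      by (simp add: lessThan_Suc_atMost[symmetric])
    finally show ?thesis
      unfolding box_density_eisenstein_at_primes[OF assms] m_def by (simp add: power_divide)
  next
    case False
    \<comment> \<open>A nonzero multiple of \<open>m\<close> has absolute value at least
      \<open>m\<close>, which exceeds \<open>N\<close> here.\<close>
    have "{a \<in> {-int N..int N}. int m dvd a \<and> a \<noteq> 0} = {}"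
      using False by (fastforce dest: dvd_imp_le_int)
    then have "eisenstein_coeffs d N S 0 = {}" using sub by auto
    then have "box_density d N (\<lambda>f. \<forall>p\<in>S. p_eisenstein p f) = 0"
      unfolding box_density_eisenstein_at_primes[OF assms] by (intro prod_zero bexI[of _ 0]) simp_all
    then show ?thesis by (simp del: of_nat_prod)
  qed
qed

text \<open>Induction on \<open>T\<close> with \<open>S\<close> arbitrary: failing at a new prime
  \<open>q\<close> means subtracting the case \<open>insert q S\<close> from the case
  \<open>S\<close>, which yields the factor \<open>1 - local_density d q\<close>. Disjointness
  ensures that \<open>q\<close> is new to \<open>S\<close>.\<close>

lemma box_density_eisenstein_exactly_tendsto:
  assumes "finite S" "S \<noteq> {}" "\<forall>p\<in>S. prime p" "d > 0"
      and "finite T" "\<forall>p\<in>T. prime p" "S \<inter> T = {}"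
  shows "(\<lambda>N. box_density d N (\<lambda>f. (\<forall>p\<in>S. p_eisenstein p f) \<and> (\<forall>p\<in>T. \<not> p_eisenstein p f)))
     \<longlonglongrightarrow> (\<Prod>p\<in>S. local_density d p) * (\<Prod>p\<in>T. 1 - local_density d p)"
  using assms(5,1,2,3,4,6,7)
proof (induction T arbitrary: S rule: finite_induct)
  case empty
  then show ?case using box_density_eisenstein_tendsto[of S d] by simp
next
  case (insert q T)
  define R where "R S f \<longleftrightarrow> (\<forall>p\<in>S. p_eisenstein p f) \<and> (\<forall>p\<in>T. \<not> p_eisenstein p f)" for S f
  have "box_density d N (\<lambda>f. (\<forall>p\<in>S. p_eisenstein p f) \<and> (\<forall>p\<in>insert q T. \<not> p_eisenstein p f))
      = box_density d N (R S) - box_density d N (R (insert q S))" for N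
  proof -
    have sub: "{f \<in> bounded_polys d N. R (insert q S) f} \<subseteq> {f \<in> bounded_polys d N. R S f}"
      by (auto simp: R_def)
    have fin: "finite {f \<in> bounded_polys d N. Q f}" for Q
      by (auto intro: finite_subset[OF _ finite_bounded_polys])
    have "{f \<in> bounded_polys d N. (\<forall>p\<in>S. p_eisenstein p f) \<and> (\<forall>p\<in>insert q T. \<not> p_eisenstein p f)}
      = {f \<in> bounded_polys d N. R S f} - {f \<in> bounded_polys d N. R (insert q S) f}"
      by (auto simp: R_def)
    then show ?thesis
      using card_Diff_subset[OF fin sub] card_mono[OF fin sub]
      by (simp add: box_density_def of_nat_diff diff_divide_distrib)
  qed
  moreover have "(\<lambda>N. box_density d N (R S)) \<longlonglongrightarrow> (\<Prod>p\<in>S. local_density d p) * (\<Prod>p\<in>T. 1 - local_density d p)"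
    unfolding R_def using insert by (intro insert.IH) auto
  moreover have "(\<lambda>N. box_density d N (R (insert q S)))
      \<longlonglongrightarrow> (\<Prod>p\<in>insert q S. local_density d p) * (\<Prod>p\<in>T. 1 - local_density d p)"
    unfolding R_def using insert by (intro insert.IH) auto
  moreover have "(\<Prod>p\<in>S. local_density d p) * (\<Prod>p\<in>T. 1 - local_density d p)
       - (\<Prod>p\<in>insert q S. local_density d p) * (\<Prod>p\<in>T. 1 - local_density d p)
     = (\<Prod>p\<in>S. local_density d p) * (\<Prod>p\<in>insert q T. 1 - local_density d p)"
    using insert by (simp add: algebra_simps)
  ultimately show ?case
    using tendsto_diff by fastforce
qed

section \<open>Termwise limits and passage to integer heights\<close>

text \<open>By the Weierstrass M-test the finite partial sums converge uniformly in
  \<open>n\<close>, so the limit along \<open>G\<close> and the limit over finite subsets of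
  \<open>X\<close> may be exchanged.\<close>

lemma tendsto_infsum_dominated:
  fixes f :: "'a \<Rightarrow> 'b \<Rightarrow> 'c::banach" and M :: "'a \<Rightarrow> real"
  assumes lim: "\<And>x. x \<in> X \<Longrightarrow> ((\<lambda>n. f x n) \<longlongrightarrow> b x) G"
      and bound: "\<And>x n. x \<in> X \<Longrightarrow> norm (f x n) \<le> M x"
      and M: "M summable_on X" and G: "G \<noteq> bot"
  shows "((\<lambda>n. \<Sum>\<^sub>\<infinity>x\<in>X. f x n) \<longlongrightarrow> (\<Sum>\<^sub>\<infinity>x\<in>X. b x)) G"
proof (rule swap_uniform_limit')
  \<comment> \<open>The bound passes to the limit because \<open>G\<close> is nontrivial; this makes
    the sum of the limits converge.\<close>
  have "norm (b x) \<le> M x" if "x \<in> X" for x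
    using tendsto_upperbound[OF tendsto_norm[OF lim[OF that]] _ G] bound[OF that] by auto
  then have "(\<lambda>x. norm (b x)) summable_on X" by (intro summable_on_comparison_test[OF M]) auto
  then have "b summable_on X" by (rule abs_summable_summable)
  then show "((\<lambda>Y. \<Sum>x\<in>Y. b x) \<longlongrightarrow> (\<Sum>\<^sub>\<infinity>x\<in>X. b x)) (finite_subsets_at_top X)"
    by (simp add: has_sum_def[symmetric])
  show "uniform_limit UNIV (\<lambda>Y n. \<Sum>x\<in>Y. f x n) (\<lambda>n. \<Sum>\<^sub>\<infinity>x\<in>X. f x n) (finite_subsets_at_top X)"
    by (rule Weierstrass_m_test_general[OF bound M])
  show "\<forall>\<^sub>F Y in finite_subsets_at_top X. ((\<lambda>n. \<Sum>x\<in>Y. f x n) \<longlongrightarrow> (\<Sum>x\<in>Y. b x)) G"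
    by (rule eventually_finite_subsets_at_top_weakI) (auto intro!: tendsto_sum lim)
qed auto

text \<open>The constant coefficient is nonzero, as \<open>p\<^sup>2\<close> does not divide it, so
  its divisor \<open>p\<close> is at most its absolute value. Hence only finitely many primes matter
  for fixed \<open>N\<close>.\<close>

lemma p_eisenstein_prime_le:
  assumes "f \<in> bounded_polys d N" "d > 0" "p_eisenstein p f"
  shows "p \<le> N"
proof -
  have a: "int p dvd coeff f 0" "coeff f 0 \<noteq> 0" "\<bar>coeff f 0\<bar> \<le> int N"
    using assms by (auto simp: p_eisenstein_def bounded_polys_def)
  then have "\<bar>int p\<bar> \<le> \<bar>coeff f 0\<bar>" by (intro dvd_imp_le_int)
  with a show ?thesis by simp
qed

lemma eisenstein_polys_of_nat:
  "eisenstein_polys d (real N) = {f \<in> bounded_polys d N. eisenstein f}"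
proof -
  have "real_of_int (poly_height f) \<le> real N \<longleftrightarrow> (\<forall>i\<le>degree f. \<bar>coeff f i\<bar> \<le> int N)" for f
  proof -
    have "real_of_int (poly_height f) \<le> real N \<longleftrightarrow> poly_height f \<le> int N" by linarith
    also have "\<dots> \<longleftrightarrow> (\<forall>i\<le>degree f. \<bar>coeff f i\<bar> \<le> int N)"
      unfolding poly_height_def by (subst Max_le_iff) auto
    finally show ?thesis .
  qed
  then show ?thesis by (auto simp: eisenstein_polys_def bounded_polys_def)
qed

text \<open>Heights are integers, so only the integer part of the bound matters; this reduces limits
  over real \<open>H\<close> to limits over natural numbers.\<close>

lemma eisenstein_polys_floor:
  assumes "H \<ge> 0"
  shows "eisenstein_polys d H = eisenstein_polys d (real (nat \<lfloor>H\<rfloor>))"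
  unfolding eisenstein_polys_def using assms by (auto simp: le_floor_iff[symmetric])

lemma tendsto_at_top_of_floor:
  assumes "\<And>H. H \<ge> (0::real) \<Longrightarrow> f H = f (real (nat \<lfloor>H\<rfloor>))" "(\<lambda>N. f (real N)) \<longlonglongrightarrow> l"
  shows "(f \<longlongrightarrow> l) at_top"
proof -
  have "filterlim (\<lambda>H::real. nat \<lfloor>H\<rfloor>) sequentially at_top"
    by (rule filterlim_compose[OF filterlim_nat_sequentially filterlim_floor_sequentially])
  then have "((\<lambda>H::real. f (real (nat \<lfloor>H\<rfloor>))) \<longlongrightarrow> l) at_top"
    by (rule filterlim_compose[OF assms(2)])
  moreover have "\<forall>\<^sub>F H in at_top. f (real (nat \<lfloor>H\<rfloor>)) = f H"
    using eventually_ge_at_top[of "0::real"] by eventually_elim (rule assms(1)[symmetric])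
  ultimately show ?thesis by (rule Lim_transform_eventually)
qed

text \<open>Double counting the related pairs turns the sum over polynomials into a sum of box
  densities over \<open>X\<close>, to which dominated convergence applies. The index
  \<open>x\<close> will be a prime, a pair of distinct primes, or the least Eisenstein
  prime.\<close>

lemma sum_card_tendsto_infsum:
  fixes R :: "int poly \<Rightarrow> 'a \<Rightarrow> bool"
  assumes fin: "\<And>N. finite {x \<in> X. \<exists>f\<in>bounded_polys d N. R f x}"
      and lim: "\<And>x. x \<in> X \<Longrightarrow> (\<lambda>N. box_density d N (\<lambda>f. R f x)) \<longlonglongrightarrow> b x"
      and bound: "\<And>x N. x \<in> X \<Longrightarrow> box_density d N (\<lambda>f. R f x) \<le> M x"
      and M: "M summable_on X"
  shows "(\<lambda>N. (\<Sum>f\<in>bounded_polys d N. real (card {x \<in> X. R f x})) / (2 * real N + 1) ^ (d + 1))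
           \<longlonglongrightarrow> (\<Sum>\<^sub>\<infinity>x\<in>X. b x)"
proof -
  have "(\<Sum>f\<in>bounded_polys d N. real (card {x \<in> X. R f x})) / (2 * real N + 1) ^ (d + 1)
      = (\<Sum>\<^sub>\<infinity>x\<in>X. box_density d N (\<lambda>f. R f x))" for N
  proof -
    define Y where "Y = {x \<in> X. \<exists>f\<in>bounded_polys d N. R f x}"
    have Y: "finite Y" unfolding Y_def by (rule fin)
    have "(\<Sum>f\<in>bounded_polys d N. card {x \<in> X. R f x}) = (\<Sum>f\<in>bounded_polys d N. card {x \<in> Y. R f x})"
      by (intro sum.cong refl arg_cong[where f = card]) (auto simp: Y_def)
    also have "\<dots> = (\<Sum>x\<in>Y. card {f \<in> bounded_polys d N. R f x})"
      by (rule sum_multicount_gen) (auto simp: Y)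
    finally have "(\<Sum>f\<in>bounded_polys d N. real (card {x \<in> X. R f x}))
        = (\<Sum>x\<in>Y. real (card {f \<in> bounded_polys d N. R f x}))"
      unfolding of_nat_sum[symmetric] by (rule arg_cong)
    then have "(\<Sum>f\<in>bounded_polys d N. real (card {x \<in> X. R f x})) / (2 * real N + 1) ^ (d + 1)
        = (\<Sum>x\<in>Y. box_density d N (\<lambda>f. R f x))"
      by (simp add: box_density_def sum_divide_distrib)
    also have "\<dots> = (\<Sum>\<^sub>\<infinity>x\<in>Y. box_density d N (\<lambda>f. R f x))" using Y by simp
    \<comment> \<open>Outside \<open>Y\<close> the densities vanish, so the index set can be made
      independent of \<open>N\<close>.\<close>
    also have "\<dots> = (\<Sum>\<^sub>\<infinity>x\<in>X. box_density d N (\<lambda>f. R f x))"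
    proof (rule infsum_cong_neutral)
      fix x assume "x \<in> X - Y"
      then have "{f \<in> bounded_polys d N. R f x} = {}" by (auto simp: Y_def)
      then show "box_density d N (\<lambda>f. R f x) = 0" by (simp add: box_density_def)
    qed (auto simp: Y_def)
    finally show ?thesis .
  qed
  moreover have "(\<lambda>N. \<Sum>\<^sub>\<infinity>x\<in>X. box_density d N (\<lambda>f. R f x)) \<longlonglongrightarrow> (\<Sum>\<^sub>\<infinity>x\<in>X. b x)"
    by (rule tendsto_infsum_dominated[OF lim _ M]) (use bound box_density_nonneg in auto)
  ultimately show ?thesis by simp
qed

section \<open>The constants alpha, beta and gamma\<close>

text \<open>The term at \<open>n = 0\<close> is 0 by the convention for division by zero, so
  \<open>A\<close> may contain 0.\<close>

lemma summable_on_inverse_power: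
  assumes "d \<ge> 2"
  shows "(\<lambda>n. c / real n ^ d) summable_on A"
proof -
  have "(\<lambda>n::nat. inverse (real n ^ d)) summable_on UNIV"
    using inverse_power_summable[OF assms, where 'a = real]
    by (subst summable_on_UNIV_nonneg_real_iff) auto
  then have "(\<lambda>n::nat. c * inverse (real n ^ d)) summable_on UNIV"
    by (rule summable_on_cmult_right)
  then show ?thesis
    unfolding divide_inverse by (rule summable_on_subset_banach) auto
qed

lemma summable_on_product_real:
  fixes f :: "'a \<Rightarrow> real" and g :: "'b \<Rightarrow> real"
  assumes "f summable_on A" "g summable_on B" "\<And>x. x \<in> A \<Longrightarrow> f x \<ge> 0" "\<And>x. x \<in> B \<Longrightarrow> g x \<ge> 0"
  shows "(\<lambda>(x, y). f x * g y) summable_on A \<times> B"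
proof (rule summable_on_SigmaI)
  show "((\<lambda>y. case (x, y) of (x, y) \<Rightarrow> f x * g y) has_sum f x * infsum g B) B" for x
    using has_sum_cmult_right[OF has_sum_infsum[OF assms(2)], of "f x"] by simp
  show "(\<lambda>x. f x * infsum g B) summable_on A" by (rule summable_on_cmult_left[OF assms(1)])
qed (use assms in auto)

lemma local_density_bounds:
  assumes "prime p"
  shows "local_density d p > 0" "local_density d p < 1" "local_density d p \<le> 1 / real p ^ d"
proof -
  have p: "real p \<ge> 2" using prime_ge_2_nat[OF assms] by simp
  show "local_density d p > 0" using p by (simp add: local_density_def)
  have "(real p - 1)\<^sup>2 < (real p)\<^sup>2" using p by (intro power_strict_mono) auto
  then have less: "local_density d p < 1 / real p ^ d"
    using p by (simp add: local_density_def power_add power2_eq_square divide_simps)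
  then show "local_density d p \<le> 1 / real p ^ d" by simp
  have "1 / real p ^ d \<le> 1" using p by (simp add: one_le_power)
  with less show "local_density d p < 1" by simp
qed

lemma summable_on_local_density:
  assumes "d \<ge> 2"
  shows "local_density d summable_on {p. prime p}"
  by (rule summable_on_comparison_test[OF summable_on_inverse_power[OF assms, of 1]])
     (use local_density_bounds in \<open>auto simp: less_imp_le\<close>)

text \<open>The sum over all pairs of primes is the square of alpha, and its diagonal part is
  beta.\<close>

lemma infsum_local_density_distinct_pairs:
  assumes "d \<ge> 2"
  shows "(\<Sum>\<^sub>\<infinity>(p, q)\<in>{(p, q). prime p \<and> prime q \<and> p \<noteq> q}. local_density d p * local_density d q)
       = (eisenstein_alpha d)\<^sup>2 - eisenstein_beta d"
proof -
  define F where "F = (\<lambda>(p, q). local_density d p * local_density d q)"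
  define D where "D = (\<lambda>p::nat. (p, p)) ` {p. prime p}"
  define X where "X = {(p::nat, q::nat). prime p \<and> prime q \<and> p \<noteq> q}"
  have F: "F summable_on {p. prime p} \<times> {p. prime p}"
    unfolding F_def using summable_on_local_density[OF assms]
    by (intro summable_on_product_real) (auto simp: less_imp_le local_density_bounds)
  have XD: "X \<union> D = {p. prime p} \<times> {p. prime p}" "X \<inter> D = {}" by (auto simp: X_def D_def)
  have "F summable_on X" "F summable_on D"
    by (rule summable_on_subset_banach[OF F]; use XD in blast)+
  then have "infsum F ({p. prime p} \<times> {p. prime p}) = infsum F X + infsum F D"
    unfolding XD(1)[symmetric] by (rule infsum_Un_disjoint[OF _ _ XD(2)])
  moreover have "infsum F D = eisenstein_beta d"
    unfolding D_def eisenstein_beta_def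
    by (subst infsum_reindex) (auto simp: inj_on_def F_def o_def power2_eq_square)
  moreover have "infsum F ({p. prime p} \<times> {p. prime p}) = (eisenstein_alpha d)\<^sup>2"
    unfolding infsum_Sigma_banach[OF F, symmetric]
    by (simp add: F_def infsum_cmult_right' infsum_cmult_left' eisenstein_alpha_def power2_eq_square)
  ultimately show ?thesis by (simp add: F_def X_def)
qed

text \<open>For prime \<open>n\<close>, \<open>b n\<close> is the limiting density of polynomials
  whose least Eisenstein prime is \<open>n\<close>. It is the drop of the partial products at
  \<open>n\<close>, so the sum telescopes to 1 minus the full product.\<close>

lemma infsum_least_prime_density:
  assumes "d \<ge> 2"
  defines "b \<equiv> (\<lambda>n. local_density d n * (\<Prod>p\<in>{p. prime p \<and> p < n}. 1 - local_density d p))"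
  shows "(\<Sum>\<^sub>\<infinity>n\<in>{n. prime n}. b n) = eisenstein_gamma d" and "eisenstein_gamma d > 0"
proof -
  define g where "g n = (if prime n then 1 - local_density d n else 1)" for n
  define P where "P n = (\<Prod>k<n. g k)" for n
  have gpos: "g n > 0" for n using local_density_bounds[of n d] by (auto simp: g_def)
  have Ppos: "P n > 0" for n unfolding P_def by (rule prod_pos) (use gpos in auto)
  \<comment> \<open>Absolute convergence of the product makes \<open>prodinf g\<close> the limit of
    its partial products.\<close>
  have "(\<lambda>n. norm (g n - 1)) summable_on UNIV"
    by (rule summable_on_comparison_test[OF summable_on_inverse_power[OF assms(1), of 1]])
       (use local_density_bounds in \<open>auto simp: g_def less_imp_le abs_of_pos\<close>)
  then have "convergent_prod g"
    by (intro abs_convergent_prod_imp_convergent_prod summable_imp_abs_convergent_prod summable_on_imp_summable)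
  then have "(\<lambda>n. \<Prod>i\<le>n. g i) \<longlonglongrightarrow> prodinf g" by (rule convergent_prod_LIMSEQ)
  then have "(\<lambda>n. P (Suc n)) \<longlonglongrightarrow> prodinf g" by (simp add: P_def lessThan_Suc_atMost)
  \<comment> \<open>\<open>P n\<close> stops before \<open>n\<close>, whereas the partial products
    of \<open>prodinf\<close> include it, hence the shift. The empty product \<open>P 0 = 1\<close>
    is the 1 left by telescoping.\<close>
  then have "P \<longlonglongrightarrow> prodinf g" by (rule LIMSEQ_imp_Suc)
  then have sums: "(\<lambda>n. P n - P (Suc n)) sums (1 - prodinf g)"
    using telescope_sums'[of P "prodinf g"] by (simp add: P_def)
  have diff: "P n - P (Suc n) = (if prime n then b n else 0)" for n
  proof -
    have "(\<Prod>p\<in>{p. prime p \<and> p < n}. 1 - local_density d p) = P n"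
      unfolding P_def by (rule prod.mono_neutral_cong_left) (auto simp: g_def)
    then show ?thesis by (simp add: b_def P_def g_def algebra_simps)
  qed
  have bpos: "b n > 0" if "prime n" for n
    unfolding b_def using local_density_bounds that by (intro mult_pos_pos prod_pos) auto
  have gamma: "eisenstein_gamma d = 1 - prodinf g" by (simp add: eisenstein_gamma_def g_def[abs_def])
  \<comment> \<open>The terms are nonnegative, so the ordered series is also an unordered
    sum.\<close>
  have "((\<lambda>n. if prime n then b n else 0) has_sum eisenstein_gamma d) UNIV"
    using sums unfolding diff gamma by (rule sums_nonneg_imp_has_sum) (auto simp: less_imp_le bpos)
  moreover have "((\<lambda>n. if prime n then b n else 0) has_sum eisenstein_gamma d) UNIV
      \<longleftrightarrow> (b has_sum eisenstein_gamma d) {n. prime n}"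
    by (rule has_sum_cong_neutral) auto
  ultimately have hs: "(b has_sum eisenstein_gamma d) {n. prime n}" by simp
  then show *: "(\<Sum>\<^sub>\<infinity>n\<in>{n. prime n}. b n) = eisenstein_gamma d" by (rule infsumI)
  \<comment> \<open>The single term at the prime 2 already forces a positive sum.\<close>
  have "sum b {2} \<le> (\<Sum>\<^sub>\<infinity>n\<in>{n. prime n}. b n)"
    using hs by (intro finite_sum_le_infsum) (auto simp: summable_on_def less_imp_le bpos)
  then show "eisenstein_gamma d > 0" using bpos[of 2] * by simp
qed

section \<open>Moments of psi and the number of Eisenstein polynomials\<close>

context
  fixes d :: nat
  assumes d: "d \<ge> 2"
begin

lemma finite_eisenstein_primes:
  assumes "f \<in> bounded_polys d N"
  shows "finite {p. prime p \<and> p_eisenstein p f}"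
  by (rule finite_subset[of _ "{..N}"]) (use p_eisenstein_prime_le assms d in auto)

lemma sum_psi_tendsto:
  "(\<lambda>N. (\<Sum>f\<in>bounded_polys d N. real (eisenstein_psi f)) / (2 * real N + 1) ^ (d + 1))
     \<longlonglongrightarrow> eisenstein_alpha d"
proof -
  have "(\<lambda>N. (\<Sum>f\<in>bounded_polys d N. real (card {p \<in> {p. prime p}. p_eisenstein p f}))
      / (2 * real N + 1) ^ (d + 1)) \<longlonglongrightarrow> (\<Sum>\<^sub>\<infinity>p\<in>{p. prime p}. local_density d p)"
  proof (rule sum_card_tendsto_infsum)
    show "finite {x \<in> {p. prime p}. \<exists>f\<in>bounded_polys d N. p_eisenstein x f}" for N
      by (rule finite_subset[of _ "{..N}"]) (use p_eisenstein_prime_le d in auto)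
    show "(\<lambda>N. box_density d N (p_eisenstein p)) \<longlonglongrightarrow> local_density d p" if "p \<in> {p. prime p}" for p
      using box_density_eisenstein_tendsto[of "{p}" d] d that by simp
    show "box_density d N (p_eisenstein p) \<le> (3 / 2) ^ d / real p ^ d" if "p \<in> {p. prime p}" for p N
      using box_density_eisenstein_le[of "{p}" d N] d that by simp
  qed (rule summable_on_inverse_power[OF d])
  then show ?thesis by (simp add: eisenstein_psi_def eisenstein_alpha_def)
qed

text \<open>The summand counts ordered pairs of distinct primes at which \<open>f\<close> is
  Eisenstein. For distinct primes the two-element set of conditions has the product of the two local
  densities as its limit.\<close>

lemma sum_psi_falling_tendsto:
  "(\<lambda>N. (\<Sum>f\<in>bounded_polys d N. real (eisenstein_psi f) * (real (eisenstein_psi f) - 1)) / (2 * real N + 1) ^ (d + 1))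
     \<longlonglongrightarrow> (eisenstein_alpha d)\<^sup>2 - eisenstein_beta d"
proof -
  define X where "X = {(p::nat, q::nat). prime p \<and> prime q \<and> p \<noteq> q}"
  define R where "R f x \<longleftrightarrow> (\<forall>p\<in>{fst x, snd x}. p_eisenstein p f)" for f and x :: "nat \<times> nat"
  have "(\<lambda>N. (\<Sum>f\<in>bounded_polys d N. real (card {x \<in> X. R f x})) / (2 * real N + 1) ^ (d + 1))
     \<longlonglongrightarrow> (\<Sum>\<^sub>\<infinity>x\<in>X. case x of (p, q) \<Rightarrow> local_density d p * local_density d q)"
  proof (rule sum_card_tendsto_infsum)
    show "finite {x \<in> X. \<exists>f\<in>bounded_polys d N. R f x}" for N
      by (rule finite_subset[of _ "{..N} \<times> {..N}"]) (use p_eisenstein_prime_le d in \<open>auto simp: R_def\<close>)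
    show "(\<lambda>N. box_density d N (\<lambda>f. R f x)) \<longlonglongrightarrow> (case x of (p, q) \<Rightarrow> local_density d p * local_density d q)"
      if "x \<in> X" for x
      using box_density_eisenstein_tendsto[of "{fst x, snd x}" d] d that by (auto simp: R_def X_def)
    show "box_density d N (\<lambda>f. R f x) \<le> (case x of (p, q) \<Rightarrow> (3 / 2) ^ d / real p ^ d * (1 / real q ^ d))"
      if "x \<in> X" for x N
      using box_density_eisenstein_le[of "{fst x, snd x}" d N] d that
      by (auto simp: R_def X_def power_mult_distrib)
    have "(\<lambda>(p, q). (3 / 2) ^ d / real p ^ d * (1 / real q ^ d)) summable_on UNIV \<times> UNIV"
      by (intro summable_on_product_real summable_on_inverse_power d) auto
    then show "(\<lambda>(p, q). (3 / 2) ^ d / real p ^ d * (1 / real q ^ d)) summable_on X"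
      by (rule summable_on_subset_banach) auto
  qed
  moreover have "real (card {x \<in> X. R f x}) = real (eisenstein_psi f) * (real (eisenstein_psi f) - 1)"
    if f: "f \<in> bounded_polys d N" for f N
  proof -
    define Q where "Q = {p. prime p \<and> p_eisenstein p f}"
    have Q: "finite Q" unfolding Q_def by (rule finite_eisenstein_primes[OF f])
    have "{x \<in> X. R f x} = (SIGMA p:Q. Q - {p})" by (auto simp: X_def R_def Q_def)
    then have "card {x \<in> X. R f x} = card Q * (card Q - 1)" using Q by simp
    then show ?thesis
      \<comment> \<open>The case split handles the truncated \<open>card Q - 1\<close> on natural
        numbers; for empty \<open>Q\<close> both sides are 0.\<close>
      by (cases "card Q") (simp_all add: eisenstein_psi_def Q_def[symmetric] algebra_simps)
  qed
  ultimately show ?thesis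
    unfolding infsum_local_density_distinct_pairs[OF d, folded X_def, symmetric] by simp
qed

text \<open>Every Eisenstein polynomial has exactly one least Eisenstein prime and all others have
  none, so the inner cardinality is the indicator of being Eisenstein.\<close>

lemma card_eisenstein_tendsto:
  "(\<lambda>N. real (card {f \<in> bounded_polys d N. eisenstein f}) / (2 * real N + 1) ^ (d + 1))
     \<longlonglongrightarrow> eisenstein_gamma d"
proof -
  define R where "R f n \<longleftrightarrow> (\<forall>p\<in>{n}. p_eisenstein p f) \<and> (\<forall>p\<in>{p. prime p \<and> p < n}. \<not> p_eisenstein p f)"
    for f and n :: nat
  have "(\<lambda>N. (\<Sum>f\<in>bounded_polys d N. real (card {n \<in> {n. prime n}. R f n})) / (2 * real N + 1) ^ (d + 1))
     \<longlonglongrightarrow> (\<Sum>\<^sub>\<infinity>n\<in>{n. prime n}. local_density d n * (\<Prod>p\<in>{p. prime p \<and> p < n}. 1 - local_density d p))"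
  proof (rule sum_card_tendsto_infsum)
    show "finite {n \<in> {n. prime n}. \<exists>f\<in>bounded_polys d N. R f n}" for N
      by (rule finite_subset[of _ "{..N}"]) (use p_eisenstein_prime_le d in \<open>auto simp: R_def\<close>)
    show "(\<lambda>N. box_density d N (\<lambda>f. R f n))
      \<longlonglongrightarrow> local_density d n * (\<Prod>p\<in>{p. prime p \<and> p < n}. 1 - local_density d p)" if "n \<in> {n. prime n}" for n
    proof -
      have "(\<lambda>N. box_density d N (\<lambda>f. R f n))
        \<longlonglongrightarrow> (\<Prod>p\<in>{n}. local_density d p) * (\<Prod>p\<in>{p. prime p \<and> p < n}. 1 - local_density d p)"
        unfolding R_def using d that by (intro box_density_eisenstein_exactly_tendsto) auto
      then show ?thesis by simp
    qed
    show "box_density d N (\<lambda>f. R f n) \<le> (3 / 2) ^ d / real n ^ d" if "n \<in> {n. prime n}" for n N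
    proof -
      \<comment> \<open>Forgetting the conditions at primes below \<open>n\<close> leaves a bound
        that is summable over \<open>n\<close>.\<close>
      have "box_density d N (\<lambda>f. R f n) \<le> box_density d N (\<lambda>f. \<forall>p\<in>{n}. p_eisenstein p f)"
        by (rule box_density_mono) (auto simp: R_def)
      also have "\<dots> \<le> (3 / 2) ^ d / real n ^ d"
        using box_density_eisenstein_le[of "{n}" d N] d that by simp
      finally show ?thesis .
    qed
  qed (rule summable_on_inverse_power[OF d])
  moreover have "card {n \<in> {n. prime n}. R f n} = (if eisenstein f then 1 else 0)" for f
  proof (cases "eisenstein f")
    case True
    define m where "m = (LEAST p. prime p \<and> p_eisenstein p f)"
    have m: "prime m \<and> p_eisenstein m f"
      unfolding m_def by (rule LeastI_ex) (use True in \<open>simp add: eisenstein_def\<close>)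
    have "n = m \<longleftrightarrow> prime n \<and> R f n" for n
    proof
      assume "n = m"
      moreover have "\<not> p_eisenstein p f" if "prime p" "p < m" for p
        using not_less_Least[of p "\<lambda>p. prime p \<and> p_eisenstein p f"] that by (simp add: m_def)
      ultimately show "prime n \<and> R f n" using m by (auto simp: R_def)
    next
      assume "prime n \<and> R f n"
      then show "n = m"
        unfolding m_def by (intro Least_equality[symmetric]) (auto simp: R_def not_less[symmetric])
    qed
    then have "{n \<in> {n. prime n}. R f n} = {m}" by auto
    then show ?thesis using True by simp
  next
    case False
    then have "{n \<in> {n. prime n}. R f n} = {}" by (auto simp: R_def eisenstein_def)
    then show ?thesis using False by (simp only: card.empty if_False)
  qed
  moreover have "(\<Sum>f\<in>bounded_polys d N. real (if eisenstein f then 1 else 0))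
      = real (card {f \<in> bounded_polys d N. eisenstein f})" for N
    by (simp add: if_distrib sum.If_cases Int_def)
  ultimately show ?thesis
    unfolding infsum_least_prime_density(1)[OF d, symmetric] by simp
qed

lemma eisenstein_psi_eq_0:
  assumes "\<not> eisenstein f"
  shows "eisenstein_psi f = 0"
proof -
  have "{p. prime p \<and> p_eisenstein p f} = {}" using assms by (auto simp: eisenstein_def)
  then show ?thesis unfolding eisenstein_psi_def by (simp only: card.empty)
qed

text \<open>Both sums are divided by the same number of coefficient vectors. The denominator then
  tends to gamma, which is positive, and the common factor cancels.\<close>

lemma psi_ratio_tendsto:
  assumes "(\<lambda>N. (\<Sum>f\<in>eisenstein_polys d (real N). h f) / (2 * real N + 1) ^ (d + 1)) \<longlonglongrightarrow> (l::real)"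
  shows "((\<lambda>H. (\<Sum>f\<in>eisenstein_polys d H. h f) / (\<Sum>f\<in>eisenstein_polys d H. 1))
            \<longlongrightarrow> l / eisenstein_gamma d) at_top"
proof (rule tendsto_at_top_of_floor)
  fix H :: real assume "H \<ge> 0"
  then show "(\<Sum>f\<in>eisenstein_polys d H. h f) / (\<Sum>f\<in>eisenstein_polys d H. 1)
    = (\<Sum>f\<in>eisenstein_polys d (real (nat \<lfloor>H\<rfloor>)). h f) / (\<Sum>f\<in>eisenstein_polys d (real (nat \<lfloor>H\<rfloor>)). 1)"
    by (simp only: eisenstein_polys_floor[of H])
next
  have "(\<lambda>N. ((\<Sum>f\<in>eisenstein_polys d (real N). h f) / (2 * real N + 1) ^ (d + 1))
          / (real (card {f \<in> bounded_polys d N. eisenstein f}) / (2 * real N + 1) ^ (d + 1)))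
      \<longlonglongrightarrow> l / eisenstein_gamma d"
    using infsum_least_prime_density(2)[OF d] by (intro tendsto_divide assms card_eisenstein_tendsto) auto
  moreover have "2 * real N + 1 \<noteq> 0" for N by linarith
  ultimately show "(\<lambda>N. (\<Sum>f\<in>eisenstein_polys d (real N). h f) / (\<Sum>f\<in>eisenstein_polys d (real N). 1))
      \<longlonglongrightarrow> l / eisenstein_gamma d"
    by (simp add: eisenstein_polys_of_nat)
qed

lemma sum_psi_eisenstein_polys_eq:
  assumes "\<And>f. \<not> eisenstein f \<Longrightarrow> h f = 0"
  shows "(\<Sum>f\<in>eisenstein_polys d (real N). h f) = (\<Sum>f\<in>bounded_polys d N. h f)"
  unfolding eisenstein_polys_of_nat by (rule sum.mono_neutral_left) (use assms in auto)

lemma psi_mean_tendsto: "(psi_mean d \<longlongrightarrow> eisenstein_alpha d / eisenstein_gamma d) at_top"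
  unfolding psi_mean_def using sum_psi_tendsto
  by (intro psi_ratio_tendsto) (simp add: sum_psi_eisenstein_polys_eq eisenstein_psi_eq_0)

lemma eisenstein_mu_eq: "eisenstein_mu d = eisenstein_alpha d / eisenstein_gamma d"
  unfolding eisenstein_mu_def by (rule tendsto_Lim[OF _ psi_mean_tendsto]) simp

lemma psi_variance_tendsto:
  "(psi_variance d \<longlongrightarrow> (eisenstein_alpha d + (eisenstein_alpha d)\<^sup>2 - eisenstein_beta d
      - eisenstein_mu d * eisenstein_alpha d) / eisenstein_gamma d) at_top"
proof -
  define \<mu> where "\<mu> = eisenstein_mu d"
  let ?s = "\<lambda>f. real (eisenstein_psi f)"
  \<comment> \<open>The square is \<open>s * (s - 1) + (1 - 2 * \<mu>) * s + \<mu>\<^sup>2\<close>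
    with \<open>s\<close> the value of psi. The first two terms vanish off the Eisenstein
    polynomials and extend to the whole box; the constant does not, so it keeps the Eisenstein
    count.\<close>
  have split: "(\<Sum>f\<in>eisenstein_polys d (real N). (?s f - \<mu>)\<^sup>2)
      = (\<Sum>f\<in>bounded_polys d N. ?s f * (?s f - 1)) + (1 - 2 * \<mu>) * (\<Sum>f\<in>bounded_polys d N. ?s f)
        + \<mu>\<^sup>2 * real (card {f \<in> bounded_polys d N. eisenstein f})" for N
  proof -
    have "(\<Sum>f\<in>eisenstein_polys d (real N). (?s f - \<mu>)\<^sup>2)
       = (\<Sum>f\<in>eisenstein_polys d (real N). ?s f * (?s f - 1) + (1 - 2 * \<mu>) * ?s f + \<mu>\<^sup>2)"
      by (rule sum.cong) (auto simp: power2_eq_square algebra_simps)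
    also have "\<dots> = (\<Sum>f\<in>eisenstein_polys d (real N). ?s f * (?s f - 1))
        + (1 - 2 * \<mu>) * (\<Sum>f\<in>eisenstein_polys d (real N). ?s f)
        + \<mu>\<^sup>2 * real (card (eisenstein_polys d (real N)))"
      by (simp add: sum.distrib sum_distrib_left)
    finally show ?thesis
      by (simp add: sum_psi_eisenstein_polys_eq eisenstein_psi_eq_0 eisenstein_polys_of_nat[symmetric])
  qed
  have "(\<lambda>N. (\<Sum>f\<in>eisenstein_polys d (real N). (?s f - \<mu>)\<^sup>2) / (2 * real N + 1) ^ (d + 1))
     \<longlonglongrightarrow> ((eisenstein_alpha d)\<^sup>2 - eisenstein_beta d) + (1 - 2 * \<mu>) * eisenstein_alpha d + \<mu>\<^sup>2 * eisenstein_gamma d"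
    unfolding split add_divide_distrib times_divide_eq_right[symmetric]
    by (intro tendsto_add tendsto_mult tendsto_const sum_psi_falling_tendsto sum_psi_tendsto card_eisenstein_tendsto)
  \<comment> \<open>Substituting this turns the last term into \<open>\<mu>\<close> times alpha,
    which cancels half of the term with \<open>2 * \<mu>\<close>.\<close>
  moreover have "\<mu> * eisenstein_gamma d = eisenstein_alpha d"
    unfolding \<mu>_def eisenstein_mu_eq using infsum_least_prime_density(2)[OF d] by simp
  then have "((eisenstein_alpha d)\<^sup>2 - eisenstein_beta d) + (1 - 2 * \<mu>) * eisenstein_alpha d + \<mu>\<^sup>2 * eisenstein_gamma d
     = eisenstein_alpha d + (eisenstein_alpha d)\<^sup>2 - eisenstein_beta d - \<mu> * eisenstein_alpha d"
    by (simp add: power2_eq_square algebra_simps)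
  ultimately show ?thesis
    unfolding psi_variance_def \<mu>_def[symmetric] by (intro psi_ratio_tendsto) simp
qed

end

theorem theorem2:
  fixes d :: nat
  assumes "d \<ge> 2"
  shows "(psi_mean d \<longlongrightarrow> eisenstein_mu d) at_top \<and>
         eisenstein_mu d = eisenstein_alpha d / eisenstein_gamma d \<and>
         (psi_variance d \<longlongrightarrow> eisenstein_sigma2 d) at_top \<and>
         eisenstein_sigma2 d =
           (eisenstein_alpha d + (eisenstein_alpha d)\<^sup>2 - eisenstein_beta d
              - eisenstein_mu d * eisenstein_alpha d) / eisenstein_gamma d"
proof -
  have "eisenstein_sigma2 d = (eisenstein_alpha d + (eisenstein_alpha d)\<^sup>2 - eisenstein_beta d
              - eisenstein_mu d * eisenstein_alpha d) / eisenstein_gamma d"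
    unfolding eisenstein_sigma2_def by (rule tendsto_Lim[OF _ psi_variance_tendsto[OF assms]]) simp
  then show ?thesis
    using psi_mean_tendsto[OF assms] psi_variance_tendsto[OF assms] eisenstein_mu_eq[OF assms] by simp
qed

end
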